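(* Let $M_0=\{(m^2,n^2) : m,n\in\mathbb{N}\}\subset\mathbb{R}^2$, where $\mathbb{N}=\{1,2,3,\ldots\}$. Then the exceptional set $\mathrm{E}(M_0)$ has full Hausdorff dimension: $\dim_{\mathrm H}(\mathrm{E}(M_0))=1$.
   Context: A set $A\subset\mathbb{R}$ is called discrete if $A\cap[-r,r]$ is finite for every $r>0$. Let $\mathbb{T}=[0,2\pi)$, and for $\alpha\in\mathbb{T}$ define $\Phi_\alpha:\mathbb{R}^2\to\mathbb{R}$ by $\Phi_\alpha(x_1,x_2)=x_1\cos\alpha+x_2\sin\alpha$. For $M\subset\mathbb{R}^2$ put $\mathrm{DEN}(M)=\{\alpha\in\mathbb{T} : \Phi_\alpha(M)\text{ is dense in }\mathbb{R}\}$, $\mathrm{DIS}(M)=\{\alpha\in\mathbb{T} : \Phi_\alpha(M)\text{ is a discrete subset of }\mathbb{R}\}$, and $\mathrm{E}(M)=\mathbb{T}\setminus(\mathrm{DEN}(M)\cup\mathrm{DIS}(M))$. Here $\dim_{\mathrm H}$ denotes Hausdorff dimension. *)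

theory Defs
  imports "HOL-Analysis.Analysis"
begin

section \<open>Hausdorff measure and Hausdorff dimension\<close>

text \<open>
  The summand \<open>(diam U)\<^sup>s\<close> of the Hausdorff measure. The case \<open>s = 0\<close> is separate because
  \<open>0 powr 0 = 0\<close> in HOL, whereas the usual convention is that a nonempty set of diameter \<open>0\<close>
  contributes \<open>1\<close> to the \<open>0\<close>-dimensional (counting) measure.
\<close>

definition diam_pow :: "real \<Rightarrow> 'a::metric_space set \<Rightarrow> ennreal" where
  "diam_pow s U =
     (if U = {} then 0 else if s = 0 then 1 else ennreal (diameter U powr s))"

text \<open>
  Covers are sequences; finite covers are included by padding with empty sets. Boundedness is
  required explicitly because \<^const>\<open>diameter\<close> is unspecified for unbounded sets.
\<close>

definition delta_covers :: "real \<Rightarrow> 'a::metric_space set \<Rightarrow> (nat \<Rightarrow> 'a set) set" where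
  "delta_covers \<delta> A =
     {U. A \<subseteq> (\<Union>i. U i) \<and> (\<forall>i. bounded (U i) \<and> diameter (U i) \<le> \<delta>)}"

definition hausdorff_pre_measure :: "real \<Rightarrow> real \<Rightarrow> 'a::metric_space set \<Rightarrow> ennreal" where
  "hausdorff_pre_measure s \<delta> A = (INF U \<in> delta_covers \<delta> A. \<Sum>i. diam_pow s (U i))"

definition hausdorff_measure :: "real \<Rightarrow> 'a::metric_space set \<Rightarrow> ennreal" where
  "hausdorff_measure s A = (SUP \<delta> \<in> {0<..}. hausdorff_pre_measure s \<delta> A)"

definition hausdorff_dim :: "'a::metric_space set \<Rightarrow> ennreal" where
  "hausdorff_dim A = (INF s \<in> {s. 0 \<le> s \<and> hausdorff_measure s A = 0}. ennreal s)"


section \<open>Projections of planar sets\<close>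

text \<open>
  This is stronger than \<^const>\<open>discrete\<close>, which only asks every point of the set to be
  isolated in it and so permits accumulation points outside the set.
\<close>

definition discrete_subset :: "real set \<Rightarrow> bool" where
  "discrete_subset A \<longleftrightarrow> (\<forall>r>0. finite (A \<inter> {-r..r}))"

definition torus :: "real set" where
  "torus = {0..<2 * pi}"

definition Phi :: "real \<Rightarrow> real \<times> real \<Rightarrow> real" where
  "Phi \<alpha> = (\<lambda>(x1, x2). x1 * cos \<alpha> + x2 * sin \<alpha>)"

definition DEN :: "(real \<times> real) set \<Rightarrow> real set" where
  "DEN M = {\<alpha> \<in> torus. closure (Phi \<alpha> ` M) = UNIV}"

definition DIS :: "(real \<times> real) set \<Rightarrow> real set" where
  "DIS M = {\<alpha> \<in> torus. discrete_subset (Phi \<alpha> ` M)}"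

definition exceptional_set :: "(real \<times> real) set \<Rightarrow> real set" where
  "exceptional_set M = torus - (DEN M \<union> DIS M)"

definition M0 :: "(real \<times> real) set" where
  "M0 = {((real m)\<^sup>2, (real n)\<^sup>2) | m n. 1 \<le> m \<and> 1 \<le> n}"

end

theory Submission
  imports Defs
begin

text \<open>
  Up to the factor \<open>cos \<alpha>\<close>, the projection in direction \<open>\<alpha> = 2\<pi> - arctan b\<^sup>2\<close> takes the values
  \<open>m\<^sup>2 - b\<^sup>2 n\<^sup>2 = (m - b n) (m + b n)\<close>. If \<open>b\<close> is badly approximable, these stay away from \<open>0\<close>. By
  Dirichlet's theorem infinitely many of the pairs \<open>(m, n)\<close> give a value in a fixed bounded interval,
  and distinct pairs give distinct values when \<open>b\<^sup>2\<close> is irrational. So \<open>\<alpha>\<close> is exceptional unless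
  \<open>b\<^sup>2\<close> is rational, which excludes only countably many \<open>b\<close>.

  The badly approximable numbers have dimension \<open>1\<close> (Jarnik): cut intervals of length about
  \<open>R\<^sup>-\<^sup>k\<close> into \<open>R = 2 N + 2\<close> parts, use every other one, and discard the at most one part close to a
  fraction with squared denominator in \<open>[R\<^sup>k, R\<^sup>k\<^sup>+\<^sup>1)\<close>. With \<open>N\<close> children each, the digit map
  from \<open>[0, 1)\<close> into the limit set has an inverse that is Hoelder of every exponent \<open>s\<close> with
  \<open>R\<^sup>s \<le> N\<close>, so Lebesgue measure bounds the \<open>s\<close>-dimensional Hausdorff measure from below.
\<close>

section \<open>Bounds for Hausdorff measure on the line\<close>

text \<open>Around any one of its points the preimage has radius at most \<open>C\<close> times the
  cost of \<open>U\<close>, so an interval of twice that length contains it. The interval stands in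
  for the preimage itself, whose measurability is not known because \<open>g\<close> is
  arbitrary.\<close>

lemma preimage_covered_diam_pow:
  fixes g :: "real \<Rightarrow> 'a::metric_space"
  assumes s: "0 \<le> s" and C: "0 \<le> C" and U: "bounded U"
    and exp: "\<And>t u. t \<in> T \<Longrightarrow> u \<in> T \<Longrightarrow> \<bar>t - u\<bar> \<le> C * dist (g t) (g u) powr s"
  shows "\<exists>I. {t \<in> T. g t \<in> U} \<subseteq> I \<and> I \<in> sets lborel \<and> emeasure lborel I \<le> ennreal (2 * C) * diam_pow s U"
proof (cases "{t \<in> T. g t \<in> U} = {}")
  case True
  then show ?thesis by (intro exI[of _ "{}"]) auto
next
  case False
  then obtain t where t: "t \<in> T" "g t \<in> U" by auto
  define D where "D = (if s = 0 then 1 else diameter U powr s)"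
  have D: "diam_pow s U = ennreal D" "0 \<le> D"
    using t by (auto simp: diam_pow_def D_def)
  have "\<bar>t - u\<bar> \<le> C * D" if "u \<in> T" "g u \<in> U" for u
  proof -
    have "dist (g t) (g u) powr s \<le> D"
      using diameter_bounded_bound[OF U t(2) that(2)] s
      by (auto simp: D_def intro!: powr_mono2)
    then show ?thesis
      using exp[OF t(1) that(1)] C by (meson mult_left_mono order_trans)
  qed
  then have "{t \<in> T. g t \<in> U} \<subseteq> {t - C * D..t + C * D}" by fastforce
  moreover have "emeasure lborel {t - C * D..t + C * D} \<le> ennreal (2 * C) * diam_pow s U"
    using C D by (simp add: ennreal_mult[symmetric] mult.assoc flip: mult_2)
  ultimately show ?thesis by (intro exI[of _ "{t - C * D..t + C * D}"]) auto
qed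

text \<open>Mass distribution argument: a cover of \<open>A\<close> pulls back along
  \<open>g\<close> to a cover of \<open>T\<close> by intervals, so its cost is at least a fixed
  multiple of the Lebesgue measure of \<open>T\<close>. The single scale 1 suffices, since the
  Hausdorff measure is a supremum over scales.\<close>

lemma hausdorff_measure_nonzero_if_expanding:
  fixes g :: "real \<Rightarrow> 'a::metric_space"
  assumes s: "0 \<le> s" and C: "0 \<le> C" and T: "T \<in> sets lborel" "emeasure lborel T \<noteq> 0"
    and A: "g ` T \<subseteq> A"
    and exp: "\<And>t u. t \<in> T \<Longrightarrow> u \<in> T \<Longrightarrow> \<bar>t - u\<bar> \<le> C * dist (g t) (g u) powr s"
  shows "hausdorff_measure s A \<noteq> 0"
proof
  assume "hausdorff_measure s A = 0"
  moreover have "hausdorff_pre_measure s 1 A \<le> hausdorff_measure s A"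
    unfolding hausdorff_measure_def by (rule SUP_upper) simp
  ultimately have pre: "hausdorff_pre_measure s 1 A = 0" by simp
  \<comment> \<open>The summand 1 keeps the divisor positive when \<open>C = 0\<close>.\<close>
  have "emeasure lborel T / ennreal (2 * C + 1) \<le> (\<Sum>i. diam_pow s (U i))" if "U \<in> delta_covers 1 A" for U
  proof -
    have U: "A \<subseteq> (\<Union>i. U i)" "\<And>i. bounded (U i)"
      using that by (auto simp: delta_covers_def)
    have "\<exists>I. \<forall>i. {t \<in> T. g t \<in> U i} \<subseteq> I i \<and> I i \<in> sets lborel
        \<and> emeasure lborel (I i) \<le> ennreal (2 * C) * diam_pow s (U i)"
      by (intro choice allI preimage_covered_diam_pow[OF s C U(2) exp])
    then obtain I where "\<forall>i. {t \<in> T. g t \<in> U i} \<subseteq> I i \<and> I i \<in> sets lborel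
        \<and> emeasure lborel (I i) \<le> ennreal (2 * C) * diam_pow s (U i)" by (rule exE)
    then have I: "{t \<in> T. g t \<in> U i} \<subseteq> I i" "I i \<in> sets lborel"
        "emeasure lborel (I i) \<le> ennreal (2 * C) * diam_pow s (U i)" for i by simp_all
    have "T \<subseteq> (\<Union>i. I i)"
    proof
      fix t assume t: "t \<in> T"
      then obtain i where "g t \<in> U i" using A U(1) by blast
      then show "t \<in> (\<Union>i. I i)" using I(1)[of i] t by blast
    qed
    then have "emeasure lborel T \<le> emeasure lborel (\<Union>i. I i)"
      using I(2) by (intro emeasure_mono) auto
    also have "\<dots> \<le> (\<Sum>i. emeasure lborel (I i))"
      using I(2) by (intro emeasure_subadditive_countably) auto
    also have "\<dots> \<le> (\<Sum>i. ennreal (2 * C) * diam_pow s (U i))"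
      using I(3) by (intro suminf_le) auto
    also have "\<dots> = ennreal (2 * C) * (\<Sum>i. diam_pow s (U i))" by simp
    also have "\<dots> \<le> ennreal (2 * C + 1) * (\<Sum>i. diam_pow s (U i))"
      by (intro mult_right_mono ennreal_leI) auto
    finally show ?thesis using C by (intro divide_le_posI_ennreal) (simp_all del: ennreal_plus)
  qed
  then have "emeasure lborel T / ennreal (2 * C + 1) \<le> hausdorff_pre_measure s 1 A"
    unfolding hausdorff_pre_measure_def by (rule INF_greatest)
  then show False
    using T(2) pre C by (simp add: ennreal_divide_eq_0_iff del: ennreal_plus)
qed

text \<open>Cutting the interval into n equal pieces costs n (L/n)^s = L^s n^(1-s), which tends to 0
  for s > 1.\<close>

lemma hausdorff_measure_eq_0_real_interval:
  fixes A :: "real set"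
  assumes A: "A \<subseteq> {0..<L}" and L: "0 < L" and s: "1 < s"
  shows "hausdorff_measure s A = 0"
proof -
  have "hausdorff_pre_measure s \<delta> A = 0" if "0 < \<delta>" for \<delta>
  proof (rule ccontr)
    assume "hausdorff_pre_measure s \<delta> A \<noteq> 0"
    then have pos: "0 < hausdorff_pre_measure s \<delta> A" by (simp add: zero_less_iff_neq_zero)
    have le: "hausdorff_pre_measure s \<delta> A \<le> ennreal (real n * (L / real n) powr s)"
      if n: "n > 0" "L / real n \<le> \<delta>" for n
    proof -
      define h where "h = L / real n"
      have h: "0 < h" "h \<le> \<delta>" "h * n = L" using n L by (simp_all add: h_def)
      define U where "U i = (if i < n then {h * i..h * (i + 1)} else {})" for i :: nat
      have diam: "diameter {h * i..h * (i + 1)} = h" for i :: nat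
        using h(1) by (simp add: distrib_left)
      have "U \<in> delta_covers \<delta> A"
        unfolding delta_covers_def mem_Collect_eq
      proof (intro conjI allI subsetI)
        fix x assume "x \<in> A"
        then have x: "0 \<le> x" "x < L" using A by auto
        define i where "i = nat \<lfloor>x / h\<rfloor>"
        have i: "real i \<le> x / h" "x / h < real i + 1"
          using x h by (auto simp: i_def)
        have "x / h < n" using x h by (simp add: field_simps)
        then have "i < n" using i by linarith
        moreover have "x \<in> {h * i..h * (i + 1)}"
          using i h by (auto simp: field_simps)
        ultimately show "x \<in> (\<Union>i. U i)" by (auto simp: U_def)
      next
        fix i
        show "bounded (U i)" by (simp add: U_def)
        show "diameter (U i) \<le> \<delta>"
          using diam h(2) \<open>0 < \<delta>\<close> by (simp add: U_def)
      qed
      then have "hausdorff_pre_measure s \<delta> A \<le> (\<Sum>i. diam_pow s (U i))"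
        unfolding hausdorff_pre_measure_def by (rule INF_lower)
      also have "\<dots> = (\<Sum>i<n. diam_pow s (U i))"
        by (rule suminf_finite) (auto simp: U_def diam_pow_def)
      also have "\<dots> \<le> (\<Sum>i<n. ennreal (h powr s))"
        using diam s by (intro sum_mono) (simp add: U_def diam_pow_def del: diameter_closed_interval)
      also have "\<dots> = ennreal (real n * (L / real n) powr s)"
        by (simp add: h_def ennreal_mult ennreal_of_nat_eq_real_of_nat)
      finally show ?thesis .
    qed
    have "(\<lambda>n. L / real n) \<longlonglongrightarrow> 0" by (rule lim_const_over_n)
    then have "\<forall>\<^sub>F n in sequentially. L / real n < \<delta>"
      using \<open>0 < \<delta>\<close> by (rule order_tendstoD)
    then have "\<forall>\<^sub>F n in sequentially. hausdorff_pre_measure s \<delta> A \<le> ennreal (real n * (L / real n) powr s)"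
      using eventually_gt_at_top[of 0] by eventually_elim (auto intro: le)
    moreover have "(\<lambda>n. L powr s * real n powr (1 - s)) \<longlonglongrightarrow> 0"
      using s by (intro tendsto_mult_right_zero tendsto_neg_powr filterlim_real_sequentially) simp
    then have "(\<lambda>n. real n * (L / real n) powr s) \<longlonglongrightarrow> 0"
      by (rule Lim_transform_eventually)
        (intro eventually_mono[OF eventually_gt_at_top[of 0]], use L in \<open>simp add: powr_divide powr_diff\<close>)
    then have "(\<lambda>n. ennreal (real n * (L / real n) powr s)) \<longlonglongrightarrow> ennreal 0"
      by (rule tendsto_ennrealI)
    ultimately have "hausdorff_pre_measure s \<delta> A \<le> ennreal 0"
      by (intro tendsto_lowerbound[where F = sequentially]) auto
    then show False using pos by simp
  qed
  then show ?thesis by (simp add: hausdorff_measure_def)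
qed

section \<open>Cantor sets parametrised by digits\<close>

text \<open>
  The map reads the base \<open>N\<close> digits of \<open>t\<close> as instructions for choosing among the \<open>N\<close> children
  \<open>e k a i\<close> (left endpoints) of the interval of length \<open>l k\<close> starting at \<open>a\<close>.
\<close>

lemma nested_intervals_expanding:
  fixes e :: "nat \<Rightarrow> real \<Rightarrow> nat \<Rightarrow> real"
  assumes N: "2 \<le> N" and s: "0 \<le> s" and C: "0 \<le> C" and l: "\<And>k. 0 < l k"
    and child: "\<And>k a i. i < N \<Longrightarrow> a \<le> e k a i" "\<And>k a i. i < N \<Longrightarrow> e k a i + l (Suc k) \<le> a + l k"
    and sep: "\<And>k a i j. i < N \<Longrightarrow> j < N \<Longrightarrow> i \<noteq> j \<Longrightarrow> 2 * l (Suc k) \<le> \<bar>e k a i - e k a j\<bar>"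
    and growth: "\<And>k. 1 / real N ^ k \<le> C * l (Suc k) powr s"
  obtains g where "\<And>t. t \<in> {0..<1} \<Longrightarrow> g t \<in> {a0..a0 + l 0}"
    and "\<And>t k. t \<in> {0..<1} \<Longrightarrow> \<exists>a. \<exists>i<N. g t \<in> {e k a i..e k a i + l (Suc k)}"
    and "\<And>t u. t \<in> {0..<1} \<Longrightarrow> u \<in> {0..<1} \<Longrightarrow> \<bar>t - u\<bar> \<le> C * \<bar>g t - g u\<bar> powr s"
proof -
  \<comment> \<open>The last k base \<open>N\<close> digits of n, most significant first, are the
    choices that lead to the stage k interval with left endpoint \<open>left k n\<close>.\<close>
  define left where "left = rec_nat (\<lambda>_. a0) (\<lambda>k f n. e k (f (n div N)) (n mod N))"
  have left_0: "left 0 n = a0" and left_Suc: "left (Suc k) n = e k (left k (n div N)) (n mod N)" for k n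
    by (simp_all add: left_def)
  \<comment> \<open>The integer formed by the first k base \<open>N\<close> digits of t; dividing it
    by \<open>N\<close> drops the last digit.\<close>
  define d where "d k t = nat \<lfloor>t * real N ^ k\<rfloor>" for k t
  have mod: "n mod N < N" for n using N by simp
  have d_Suc: "d (Suc k) t div N = d k t" if "0 \<le> t" for k t
  proof -
    have "\<lfloor>t * real N ^ Suc k\<rfloor> div int N = \<lfloor>t * real N ^ Suc k / real N\<rfloor>"
      by (metis floor_divide_real_eq_div of_int_of_nat_eq of_nat_0_le_iff)
    also have "t * real N ^ Suc k / real N = t * real N ^ k" using N by simp
    finally have eq: "\<lfloor>t * real N ^ Suc k\<rfloor> div int N = \<lfloor>t * real N ^ k\<rfloor>" .
    have "0 \<le> \<lfloor>t * real N ^ Suc k\<rfloor>" using that by simp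
    then show ?thesis unfolding d_def eq[symmetric] by (simp add: nat_div_distrib)
  qed
  define x where "x t k = left k (d k t)" for t k
  have x_Suc: "x t (Suc k) = e k (x t k) (d (Suc k) t mod N)" if "0 \<le> t" for t k
    using d_Suc[OF that] by (simp add: x_def left_Suc)
  have inc: "incseq (x t)" if "0 \<le> t" for t
    by (intro incseq_SucI) (simp add: x_Suc that child(1) mod)
  have dec: "decseq (\<lambda>k. x t k + l k)" if "0 \<le> t" for t
    by (intro decseq_SucI) (simp add: x_Suc that child(2) mod)
  have nested: "x t k \<le> x t j + l j" if "0 \<le> t" for t k j
  proof -
    have "x t k \<le> x t (max j k)" using inc[OF that] by (simp add: incseqD)
    also have "\<dots> \<le> x t (max j k) + l (max j k)" using l[of "max j k"] by simp
    also have "\<dots> \<le> x t j + l j" using decseqD[OF dec[OF that], of j "max j k"] by simp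
    finally show ?thesis .
  qed
  define g where "g t = (SUP k. x t k)" for t
  have g: "x t k \<le> g t" "g t \<le> x t k + l k" if "0 \<le> t" for t k
  proof -
    have "bdd_above (range (x t))" by (intro bdd_aboveI2[where M = "x t 0 + l 0"] nested[OF that])
    then show "x t k \<le> g t" unfolding g_def by (intro cSUP_upper) auto
    show "g t \<le> x t k + l k" unfolding g_def by (intro cSUP_least nested[OF that]) auto
  qed
  show thesis
  proof
    fix t :: real assume t: "t \<in> {0..<1}"
    then show "g t \<in> {a0..a0 + l 0}" using g[of t 0] by (simp add: x_def left_0)
    show "\<exists>a. \<exists>i<N. g t \<in> {e k a i..e k a i + l (Suc k)}" for k
      using g[of t "Suc k"] t x_Suc[of t k] by (intro exI[of _ "x t k"] exI[of _ "d (Suc k) t mod N"]) (simp add: mod)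
  next
    fix t u :: real assume t: "t \<in> {0..<1}" and u: "u \<in> {0..<1}"
    show "\<bar>t - u\<bar> \<le> C * \<bar>g t - g u\<bar> powr s"
    proof (cases "t = u")
      case False
      have close: "\<bar>t - u\<bar> \<le> 1 / real N ^ k" if "d k t = d k u" for k
      proof -
        have "\<lfloor>t * real N ^ k\<rfloor> = \<lfloor>u * real N ^ k\<rfloor>"
          using that t u by (simp add: d_def eq_nat_nat_iff)
        then have "\<bar>t * real N ^ k - u * real N ^ k\<bar> \<le> 1" by linarith
        then have "\<bar>t - u\<bar> * real N ^ k \<le> 1"
          by (simp flip: left_diff_distrib add: abs_mult)
        then show ?thesis using N by (simp add: field_simps)
      qed
      obtain n where n: "d n t \<noteq> d n u"
      proof (rule ccontr)
        assume "\<not> thesis"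
        then have "d k t = d k u" for k using that by blast
        then have "\<bar>t - u\<bar> \<le> 1 / real N ^ k" for k using close by simp
        moreover have "(\<lambda>k. 1 / real N ^ k) \<longlonglongrightarrow> 0"
          using N LIMSEQ_inverse_realpow_zero[of "real N"] by (simp add: inverse_eq_divide)
        ultimately have "\<bar>t - u\<bar> \<le> 0"
          by (intro LIMSEQ_le_const) auto
        then show False using False by simp
      qed
      have "d 0 t = d 0 u" using t u by (simp add: d_def floor_eq_iff)
      \<comment> \<open>At the first disagreement of the digits, t and u still share a parent
        interval but choose different children.\<close>
      then obtain k where k: "d k t = d k u" "d (Suc k) t \<noteq> d (Suc k) u"
        using n ex_least_nat_less[of "\<lambda>k. d k t \<noteq> d k u" n] by blast
      have "d (Suc k) t mod N \<noteq> d (Suc k) u mod N"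
        using k d_Suc[of t k] d_Suc[of u k] t u by (metis atLeastLessThan_iff mult_div_mod_eq)
      then have "2 * l (Suc k) \<le> \<bar>x t (Suc k) - x u (Suc k)\<bar>"
        using t u sep[OF mod mod] k(1) by (simp add: x_Suc) (simp add: x_def)
      \<comment> \<open>Left endpoints are at least two lengths apart, and each point lies at most
        one length to the right of its own.\<close>
      then have "l (Suc k) \<le> \<bar>g t - g u\<bar>"
        using g[of t "Suc k"] g[of u "Suc k"] t u by auto
      then have "C * l (Suc k) powr s \<le> C * \<bar>g t - g u\<bar> powr s"
        using l[of "Suc k"] s C by (intro mult_left_mono powr_mono2) auto
      then show ?thesis using close[OF k(1)] growth[of k] by linarith
    qed simp
  qed
qed

section \<open>Jarnik's construction of badly approximable numbers\<close>

lemma badly_approximable_cantor: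
  fixes s :: real
  assumes s: "0 \<le> s" "s < 1"
  obtains c C g where "0 < c" "0 \<le> C"
    and "\<And>t. t \<in> {0..<1} \<Longrightarrow> g t \<in> {1..2::real}"
    and "\<And>t p q. t \<in> {0..<1} \<Longrightarrow> 0 < (q::nat) \<Longrightarrow> c / real q \<le> \<bar>real q * g t - of_int p\<bar>"
    and "\<And>t u. t \<in> {0..<1} \<Longrightarrow> u \<in> {0..<1} \<Longrightarrow> \<bar>t - u\<bar> \<le> C * \<bar>g t - g u\<bar> powr s"
proof -
  \<comment> \<open>Chosen so that 4^s \<le> N^(1-s); as R \<le> 4 N, this yields R^s \<le>
    N.\<close>
  define N where "N = max 2 (nat \<lceil>4 powr (s / (1 - s)) :: real\<rceil>)"
  have N: "2 \<le> N" "4 powr s \<le> real N powr (1 - s)"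
  proof -
    have "4 powr (s / (1 - s)) \<le> real N" unfolding N_def by linarith
    then have "(4 powr (s / (1 - s))) powr (1 - s) \<le> real N powr (1 - s)"
      using s by (intro powr_mono2) auto
    then show "4 powr s \<le> real N powr (1 - s)" using s by (simp add: powr_powr)
  qed (simp add: N_def)
  define R where "R = real (2 * N + 2)"
  have R: "2 * real N + 2 = R" "6 \<le> R" "R \<le> 4 * real N" using N by (simp_all add: R_def)
  have Rs: "R powr s \<le> real N"
  proof -
    have "R powr s \<le> (4 * real N) powr s" using R s by (intro powr_mono2) auto
    also have "\<dots> \<le> real N powr (1 - s) * real N powr s"
      using N by (simp add: powr_mult)
    also have "\<dots> = real N" using N by (simp flip: powr_add)
    finally show ?thesis .
  qed
  \<comment> \<open>The factor 1/2 makes distinct fractions with squared denominators below R^(k+1)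
    more than \<open>2 * l k\<close> apart. The constant \<open>c\<close> below is fitted so that c
    / R^k is a quarter of \<open>l (Suc k)\<close>.\<close>
  define l where "l k = 1 / (2 * R ^ Suc k)" for k
  have l: "0 < l k" for k using R by (simp add: l_def)
  have l_Suc: "l k = R * l (Suc k)" for k using R by (simp add: l_def)
  define c where "c = 1 / (8 * R ^ 2)"
  define bad where "bad k x \<longleftrightarrow> (\<exists>p q. 0 < q \<and> R ^ k \<le> (real q)\<^sup>2 \<and> (real q)\<^sup>2 < R ^ Suc k
      \<and> \<bar>real q * x - of_int p\<bar> < c / real q)" for k and x :: real
  have bad_close: "\<bar>x - y\<bar> < l (Suc k)" if bad: "bad k x" "bad k y" and xy: "\<bar>x - y\<bar> \<le> l k" for k x y
  proof -
    obtain p q where q: "0 < q" "R ^ k \<le> (real q)\<^sup>2" "(real q)\<^sup>2 < R ^ Suc k" "\<bar>real q * x - of_int p\<bar> < c / real q"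
      using bad(1) unfolding bad_def by blast
    obtain p' q' where q': "0 < q'" "R ^ k \<le> (real q')\<^sup>2" "(real q')\<^sup>2 < R ^ Suc k" "\<bar>real q' * y - of_int p'\<bar> < c / real q'"
      using bad(2) unfolding bad_def by blast
    have near: "\<bar>z - of_int p / real q\<bar> < l (Suc k) / 4"
      if "0 < q" "R ^ k \<le> (real q)\<^sup>2" "\<bar>real q * z - of_int p\<bar> < c / real q" for z p and q :: nat
    proof -
      have "\<bar>z - of_int p / real q\<bar> = \<bar>real q * z - of_int p\<bar> / real q"
        using that(1) by (simp add: field_simps flip: abs_div_pos)
      also have "\<dots> < c / real q / real q"
        using that(1,3) by (intro divide_strict_right_mono) auto
      also have "\<dots> = c / (real q)\<^sup>2" by (simp add: power2_eq_square)
      also have "\<dots> \<le> c / R ^ k"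
        using that(2) R by (intro divide_left_mono) (auto simp: c_def intro!: mult_pos_pos less_le_trans[OF _ that(2)])
      also have "\<dots> = l (Suc k) / 4"
        by (simp add: c_def l_def power2_eq_square mult_ac)
      finally show ?thesis .
    qed
    note nx = near[OF q(1,2,4)] and ny = near[OF q'(1,2,4)]
    \<comment> \<open>Otherwise the fractions would be more than \<open>2 * l k\<close> apart,
      whereas through x and y their distance is below \<open>l k + l (Suc k) / 2\<close>.\<close>
    have "of_int p / real q = of_int p' / real q'"
    proof (rule ccontr)
      assume "of_int p / real q \<noteq> of_int p' / real q'"
      then have "p * int q' \<noteq> p' * int q"
        using q(1) q'(1) by (simp add: field_simps) (metis of_int_mult of_int_of_nat_eq)
      then have "1 \<le> \<bar>p * int q' - p' * int q\<bar>" by linarith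
      then have "1 \<le> real_of_int \<bar>p * int q' - p' * int q\<bar>" by (simp only: of_int_1_le_iff)
      then have "1 \<le> \<bar>of_int p * real q' - of_int p' * real q\<bar>" by simp
      moreover have "of_int p / real q - of_int p' / real q' = (of_int p * real q' - of_int p' * real q) / (real q * real q')"
        using q(1) q'(1) by (simp add: field_simps)
      ultimately have "1 / (real q * real q') \<le> \<bar>of_int p / real q - of_int p' / real q'\<bar>"
        using q(1) q'(1) by (simp add: divide_right_mono)
      \<comment> \<open>The product is at most the mean of the two squares.\<close>
      moreover have "real q * real q' < R ^ Suc k"
      proof -
        have "0 \<le> (real q - real q')\<^sup>2" by simp
        then show ?thesis using q(3) q'(3) by (simp add: power2_diff)
      qed
      then have "2 * l k < 1 / (real q * real q')"
        using q(1) q'(1) by (simp add: l_def frac_less2)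
      moreover have "l (Suc k) \<le> l k" using l_Suc[of k] l[of "Suc k"] R by simp
      ultimately show False using nx ny xy l[of k] by linarith
    qed
    then show ?thesis using nx ny l[of "Suc k"] by linarith
  qed
  \<comment> \<open>The indices 0 to \<open>N\<close> give N + 1 candidates, one more than required,
    and they fit because 2 N + 1 \<le> R.\<close>
  define child where "child k a j = a + 2 * real j * l (Suc k)" for k a j
  have child_sep: "2 * l (Suc k) \<le> \<bar>child k a i - child k a j\<bar>" if "i \<noteq> j" for k a i j
  proof -
    have "child k a i - child k a j = 2 * l (Suc k) * (real i - real j)"
      by (simp add: child_def algebra_simps)
    moreover have "1 \<le> \<bar>real i - real j\<bar>" using that by linarith
    ultimately show ?thesis using l[of "Suc k"] by (simp add: abs_mult)
  qed
  have child_le: "child k a j + l (Suc k) \<le> a + l k" if "j \<le> N" for k a j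
  proof -
    have "(2 * real j + 1) * l (Suc k) \<le> R * l (Suc k)"
      using that R l[of "Suc k"] by (intro mult_right_mono) auto
    then show ?thesis by (simp add: child_def l_Suc[of k] algebra_simps)
  qed
  have child_ge: "a \<le> child k a j" for k a j
    using l[of "Suc k"] by (simp add: child_def)
  define spoiled where "spoiled k a j \<longleftrightarrow> (\<exists>x \<in> {child k a j..child k a j + l (Suc k)}. bad k x)" for k a j
  \<comment> \<open>Distinct fractions with denominators of stage \<open>k\<close> are too far apart for one interval to meet
    two of them, and the gaps between the children are too wide for one fraction to spoil two.\<close>
  have "\<exists>j0. \<forall>j\<le>N. j \<noteq> j0 \<longrightarrow> \<not> spoiled k a j" for k a
  proof (rule ccontr)
    assume *: "\<not> ?thesis"
    from * obtain i where i: "i \<le> N" "spoiled k a i" by blast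
    from * obtain j where j: "j \<le> N" "spoiled k a j" "j \<noteq> i" by blast
    obtain x y where x: "x \<in> {child k a i..child k a i + l (Suc k)}" "bad k x"
      and y: "y \<in> {child k a j..child k a j + l (Suc k)}" "bad k y"
      using i j unfolding spoiled_def by blast
    have "\<bar>x - y\<bar> \<le> l k"
      using x(1) y(1) child_ge[of a k] child_le[OF i(1), of k a] child_le[OF j(1), of k a] 
      unfolding atLeastAtMost_iff by (smt (verit))
    then have "\<bar>x - y\<bar> < l (Suc k)" using bad_close x y by blast
    then show False using child_sep[OF j(3), of k a] x(1) y(1) by auto
  qed
  then obtain skip where skip: "\<And>k a j. j \<le> N \<Longrightarrow> j \<noteq> skip k a \<Longrightarrow> \<not> spoiled k a j"
    by metis
  \<comment> \<open>Steps over the index \<open>skip k a\<close>, so that the \<open>N\<close>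
    indices below \<open>N\<close> reach distinct unspoiled candidates.\<close>
  define keep where "keep k a i = (if i < skip k a then i else Suc i)" for k a i
  have keep: "keep k a i \<le> N" "keep k a i \<noteq> skip k a" if "i < N" for k a i
    using that by (auto simp: keep_def)
  have keep_inj: "keep k a i \<noteq> keep k a j" if "i \<noteq> j" for k a i j
    using that by (auto simp: keep_def)
  \<comment> \<open>Since 1 / R^k = 2 R^2 \<open>l (Suc k)\<close>, this constant turns R^s \<le> N
    into the growth condition.\<close>
  define C where "C = (2 * R\<^sup>2) powr s"
  have C: "0 \<le> C" by (simp add: C_def)
  have growth: "1 / real N ^ k \<le> C * l (Suc k) powr s" for k
  proof -
    have "(R powr s) ^ k \<le> real N ^ k" using Rs by (intro power_mono) auto
    then have "1 / real N ^ k \<le> 1 / (R powr s) ^ k"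
      using R by (intro divide_left_mono) auto
    also have "\<dots> = 1 / (R ^ k) powr s"
      using R by (simp add: powr_realpow[symmetric] powr_powr mult.commute)
    also have "\<dots> = (1 / R ^ k) powr s" using R by (simp add: powr_divide)
    also have "1 / R ^ k = 2 * R\<^sup>2 * l (Suc k)" using R by (simp add: l_def power2_eq_square)
    also have "\<dots> powr s = C * l (Suc k) powr s"
      using R l[of "Suc k"] by (simp add: C_def powr_mult)
    finally show ?thesis .
  qed
  obtain g where g: "\<And>t. t \<in> {0..<1} \<Longrightarrow> g t \<in> {1..1 + l 0}"
    "\<And>t k. t \<in> {0..<1} \<Longrightarrow> \<exists>a. \<exists>i<N. g t \<in> {child k a (keep k a i)..child k a (keep k a i) + l (Suc k)}"
    "\<And>t u. t \<in> {0..<1} \<Longrightarrow> u \<in> {0..<1} \<Longrightarrow> \<bar>t - u\<bar> \<le> C * \<bar>g t - g u\<bar> powr s"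
  proof (rule nested_intervals_expanding[where e = "\<lambda>k a i. child k a (keep k a i)" and N = N and s = s
        and C = C and l = l and ?a0.0 = 1])
    show "2 * l (Suc k) \<le> \<bar>child k a (keep k a i) - child k a (keep k a j)\<bar>" if "i \<noteq> j" for k a i j
      using that by (intro child_sep keep_inj)
  qed (use N s C l growth child_ge child_le keep in auto)
  show thesis
  proof
    show "0 < c" using R by (simp add: c_def)
    show "0 \<le> C" by (fact C)
    have "l 0 \<le> 1" using R by (simp add: l_def)
    then show "g t \<in> {1..2}" if "t \<in> {0..<1}" for t using g(1)[OF that] by simp
    show "\<bar>t - u\<bar> \<le> C * \<bar>g t - g u\<bar> powr s" if "t \<in> {0..<1}" "u \<in> {0..<1}" for t u
      using g(3) that by blast
    show "c / real q \<le> \<bar>real q * g t - of_int p\<bar>" if t: "t \<in> {0..<1}" and q: "0 < q" for t p q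
    proof -
      \<comment> \<open>Each denominator belongs to exactly one stage, and the child chosen at that
        stage contains no point bad for it.\<close>
      obtain k where k: "R ^ k \<le> (real q)\<^sup>2" "(real q)\<^sup>2 < R ^ Suc k"
      proof -
        obtain n where n: "(real q)\<^sup>2 < R ^ n" using real_arch_pow[of R "(real q)\<^sup>2"] R by auto
        moreover have "\<not> (real q)\<^sup>2 < R ^ 0" using q by (simp add: not_less)
        ultimately show ?thesis
          using ex_least_nat_less[of "\<lambda>n. (real q)\<^sup>2 < R ^ n" n] that by (meson le_refl not_less)
      qed
      obtain a i where "i < N" "g t \<in> {child k a (keep k a i)..child k a (keep k a i) + l (Suc k)}"
        using g(2)[OF t] by blast
      then have "\<not> bad k (g t)"
        using skip[OF keep] unfolding spoiled_def by blast
      then show ?thesis using k q unfolding bad_def by (meson not_less)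
    qed
  qed
qed

section \<open>Exceptional directions from badly approximable numbers\<close>

lemma Phi_arctan:
  "Phi (2 * pi - arctan (b\<^sup>2)) (x, y) = cos (arctan (b\<^sup>2)) * (x - b\<^sup>2 * y)"
  by (simp add: Phi_def sin_diff cos_diff sin_arctan cos_arctan field_simps diff_divide_distrib)

text \<open>The values are injective in the pair: two equal values with different n would express
  b^2 as a quotient of integers.\<close>

lemma finite_if_finite_quadratic_values:
  fixes b :: real
  assumes irr: "b\<^sup>2 \<notin> \<rat>" and K: "K \<noteq> 0"
    and fin: "finite ((\<lambda>(m, n). K * ((real m)\<^sup>2 - b\<^sup>2 * (real n)\<^sup>2)) ` S)"
  shows "finite S"
proof -
  have "inj_on (\<lambda>(m, n). K * ((real m)\<^sup>2 - b\<^sup>2 * (real n)\<^sup>2)) S"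
  proof (rule inj_onI, clarify)
    fix m n m' n' :: nat
    assume "K * ((real m)\<^sup>2 - b\<^sup>2 * (real n)\<^sup>2) = K * ((real m')\<^sup>2 - b\<^sup>2 * (real n')\<^sup>2)"
    then have "(real m)\<^sup>2 - b\<^sup>2 * (real n)\<^sup>2 = (real m')\<^sup>2 - b\<^sup>2 * (real n')\<^sup>2"
      by (rule iffD1[OF mult_left_cancel[OF K]])
    then have eq: "(real m)\<^sup>2 - (real m')\<^sup>2 = b\<^sup>2 * ((real n)\<^sup>2 - (real n')\<^sup>2)"
      by (simp add: algebra_simps)
    have n: "(real n)\<^sup>2 = (real n')\<^sup>2"
    proof (rule ccontr)
      assume "(real n)\<^sup>2 \<noteq> (real n')\<^sup>2"
      then have "b\<^sup>2 = ((real m)\<^sup>2 - (real m')\<^sup>2) / ((real n)\<^sup>2 - (real n')\<^sup>2)"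
        by (simp add: eq)
      also have "\<dots> \<in> \<rat>" by simp
      finally show False using irr by simp
    qed
    then have "(real m)\<^sup>2 = (real m')\<^sup>2" using eq by simp
    with n show "m = m' \<and> n = n'" by simp
  qed
  then show ?thesis by (rule finite_imageD[OF fin])
qed

lemma exceptional_if_badly_approximable:
  fixes b :: real
  assumes b: "1 \<le> b" "b \<le> 2" and irr: "b\<^sup>2 \<notin> \<rat>" and c: "0 < c"
    and bad: "\<And>p q. 0 < (q::nat) \<Longrightarrow> c / real q \<le> \<bar>real q * b - of_int p\<bar>"
  shows "2 * pi - arctan (b\<^sup>2) \<in> exceptional_set M0"
proof -
  define K where "K = cos (arctan (b\<^sup>2))"
  define \<alpha> where "\<alpha> = 2 * pi - arctan (b\<^sup>2)"
  have K: "0 < K" "K \<le> 1" by (simp_all add: K_def cos_arctan add_pos_nonneg)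
  have Phi: "Phi \<alpha> (x, y) = K * (x - b\<^sup>2 * y)" for x y
    unfolding K_def \<alpha>_def by (rule Phi_arctan)
  have factor: "(real m)\<^sup>2 - b\<^sup>2 * (real n)\<^sup>2 = - ((real n * b - real m) * (real n * b + real m))" for m n
    by (simp add: algebra_simps power2_eq_square)
  have "0 < arctan (b\<^sup>2)" using b by simp
  moreover have "arctan (b\<^sup>2) < pi / 2" by (rule arctan_ubound)
  ultimately have torus: "\<alpha> \<in> torus" unfolding torus_def \<alpha>_def atLeastLessThan_iff by linarith
  have "\<alpha> \<notin> DEN M0"
  \<comment> \<open>The bounds |n b - m| \<ge> c/n and n b + m \<ge> n multiply to c, so the
    projection misses the interval (-K c, K c).\<close>
  proof
    assume "\<alpha> \<in> DEN M0"
    then have "0 \<in> closure (Phi \<alpha> ` M0)" by (auto simp: DEN_def)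
    moreover have "0 < K * c" using K c by simp
    ultimately obtain z where "z \<in> M0" and z: "\<bar>Phi \<alpha> z\<bar> < K * c"
      unfolding closure_approachable by (auto simp: dist_real_def)
    then obtain m n where mn: "z = ((real m)\<^sup>2, (real n)\<^sup>2)" "1 \<le> n" by (auto simp: M0_def)
    have "c = c / real n * real n" using mn(2) by simp
    also have "\<dots> \<le> \<bar>real n * b - real m\<bar> * (real n * b + real m)"
    proof (rule mult_mono)
      show "c / real n \<le> \<bar>real n * b - real m\<bar>" using bad[of n "int m"] mn(2) by simp
      show "real n \<le> real n * b + real m" using b(1) mult_left_mono[of 1 b "real n"] by simp
    qed auto
    also have "\<dots> = \<bar>(real m)\<^sup>2 - b\<^sup>2 * (real n)\<^sup>2\<bar>"
      using b(1) by (simp add: factor abs_mult)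
    finally have "K * c \<le> \<bar>Phi \<alpha> z\<bar>"
      using K(1) by (simp add: mn Phi abs_mult)
    then show False using z by simp
  qed
  moreover have "\<alpha> \<notin> DIS M0"
  proof
    assume "\<alpha> \<in> DIS M0"
    \<comment> \<open>The bound 5 comes from the Dirichlet pairs used below: |n b - m| < 1/n, and n
      b + m \<le> 5 n because b \<le> 2 and m \<le> n b + 1. Multiplying by K \<le> 1 keeps the
      values in the interval.\<close>
    then have fin: "finite (Phi \<alpha> ` M0 \<inter> {-5..5})" by (simp add: DIS_def discrete_subset_def)
    define S where "S = {(m, n). 1 \<le> m \<and> 1 \<le> n \<and> \<bar>(real m)\<^sup>2 - b\<^sup>2 * (real n)\<^sup>2\<bar> \<le> 5}"
    have "(\<lambda>(m, n). K * ((real m)\<^sup>2 - b\<^sup>2 * (real n)\<^sup>2)) ` S \<subseteq> Phi \<alpha> ` M0 \<inter> {-5..5}"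
    proof (clarify, intro IntI)
      fix m n assume mn: "(m, n) \<in> S"
      show "K * ((real m)\<^sup>2 - b\<^sup>2 * (real n)\<^sup>2) \<in> Phi \<alpha> ` M0"
        using mn by (intro image_eqI[of _ _ "((real m)\<^sup>2, (real n)\<^sup>2)"]) (auto simp: Phi S_def M0_def)
      have "\<bar>K * ((real m)\<^sup>2 - b\<^sup>2 * (real n)\<^sup>2)\<bar> \<le> 1 * 5"
        unfolding abs_mult using mn K by (intro mult_mono) (auto simp: S_def)
      then show "K * ((real m)\<^sup>2 - b\<^sup>2 * (real n)\<^sup>2) \<in> {-5..5}" by (simp add: abs_le_iff)
    qed
    then have "finite S"
      using K(1) finite_subset[OF _ fin] by (intro finite_if_finite_quadratic_values[OF irr, of K]) auto
    then have "finite (snd ` S)" by simp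
    then obtain B where B: "n \<le> B" if "n \<in> snd ` S" for n
      by (meson finite_nat_set_iff_bounded_le)
    \<comment> \<open>This forces a large denominator: c/n \<le> |n b - m| < 1/N gives n > c N > B +
      1, against the bound B on the second coordinates in \<open>S\<close>.\<close>
    obtain N :: nat where N: "(real B + 1) / c < real N" using reals_Archimedean2 by blast
    then have "0 < real N" using c by (smt (verit) divide_nonneg_pos of_nat_0_le_iff)
    then have "0 < N" by simp
    then obtain h k where hk: "0 < k" "k \<le> int N" "\<bar>of_int k * b - of_int h\<bar> < 1 / N"
      by (rule Dirichlet_approx)
    define n where "n = nat k"
    have n: "k = int n" "0 < n" "n \<le> N" using hk by (simp_all add: n_def)
    have small: "\<bar>real n * b - of_int h\<bar> < 1 / N" using hk(3) n(1) by simp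
    have "1 / real N \<le> 1" using \<open>0 < real N\<close> by simp
    moreover have nb: "real n \<le> real n * b" "real n * b \<le> 2 * real n"
      using b mult_left_mono[of 1 b "real n"] mult_left_mono[of b 2 "real n"] by simp_all
    ultimately have "0 < h" using small n(2) by linarith
    define m where "m = nat h"
    have m: "h = int m" "1 \<le> m" using \<open>0 < h\<close> by (simp_all add: m_def)
    have small: "\<bar>real n * b - real m\<bar> < 1 / N" using small m(1) by simp
    have "\<bar>(real m)\<^sup>2 - b\<^sup>2 * (real n)\<^sup>2\<bar> = \<bar>real n * b - real m\<bar> * (real n * b + real m)"
      using b(1) by (simp add: factor abs_mult)
    also have "\<dots> \<le> 1 / real n * (5 * real n)"
    proof (rule mult_mono)
      have "1 / real N \<le> 1 / real n" using n by (simp add: frac_le)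
      then show "\<bar>real n * b - real m\<bar> \<le> 1 / real n" using small by linarith
      show "real n * b + real m \<le> 5 * real n"
        using small nb \<open>1 / real N \<le> 1\<close> n(2) by linarith
    qed (use b in auto)
    also have "\<dots> = 5" using n by simp
    finally have "(m, n) \<in> S" using m n by (simp add: S_def)
    then have "n \<le> B" using B by force
    have "c / real n < 1 / real N" using bad[OF n(2), of "int m"] small by simp
    then have "real N * c < real n" using \<open>0 < real N\<close> n(2) by (simp add: field_simps)
    moreover have "real B + 1 < real N * c" using N c by (simp add: field_simps)
    ultimately show False using \<open>n \<le> B\<close> by simp
  qed
  ultimately show ?thesis using torus by (simp add: exceptional_set_def \<alpha>_def)
qed

section \<open>Transfer to angles and the dimension\<close>

text \<open>Mean value theorem: on [1, 2] the derivative 2 z / (1 + z^4) has numerator at least 2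
  and denominator at most 17.\<close>

lemma arctan_square_expanding:
  fixes x y :: real
  assumes "x \<in> {1..2}" "y \<in> {1..2}"
  shows "\<bar>x - y\<bar> \<le> 17 / 2 * \<bar>arctan (x\<^sup>2) - arctan (y\<^sup>2)\<bar>"
  using assms
proof (induction x y rule: linorder_wlog)
  case (le x y)
  show ?case
  proof (cases "x = y")
    case False
    then have xy: "x < y" using le by simp
    obtain z where z: "x < z" "z < y" "arctan (y\<^sup>2) - arctan (x\<^sup>2) = (y - x) * (2 * z / (1 + (z\<^sup>2)\<^sup>2))"
    proof (rule exE[OF MVT2[OF xy, of "\<lambda>x. arctan (x\<^sup>2)" "\<lambda>z. 2 * z / (1 + (z\<^sup>2)\<^sup>2)"]])
      show "((\<lambda>x. arctan (x\<^sup>2)) has_real_derivative 2 * z / (1 + (z\<^sup>2)\<^sup>2)) (at z)" for z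
        by (auto intro!: derivative_eq_intros simp: field_simps)
    qed auto
    have "z ^ 4 \<le> 2 ^ 4" using z le by (intro power_mono) auto
    then have "2 / 17 \<le> 2 * z / (1 + (z\<^sup>2)\<^sup>2)"
      using z le by (intro frac_le) (auto simp: add_pos_nonneg)
    then have "(y - x) * (2 / 17) \<le> arctan (y\<^sup>2) - arctan (x\<^sup>2)"
      using xy unfolding z(3) by (intro mult_left_mono) auto
    then show ?thesis using xy by simp
  qed simp
qed (simp add: abs_minus_commute)

theorem proposition4p1:
  shows "hausdorff_dim (exceptional_set M0) = 1"
proof (rule antisym)
  have "hausdorff_measure s (exceptional_set M0) = 0" if "1 < s" for s
    using that by (intro hausdorff_measure_eq_0_real_interval[where L = "2 * pi"])
      (auto simp: exceptional_set_def torus_def)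
  \<comment> \<open>Only exponents strictly above 1 are known to give measure 0, so 1 is approached
    from above.\<close>
  then have "hausdorff_dim (exceptional_set M0) \<le> 1 + ennreal e" if "0 < e" for e
    unfolding hausdorff_dim_def using that by (intro INF_lower2[of "1 + e"]) auto
  then show "hausdorff_dim (exceptional_set M0) \<le> 1" by (rule ennreal_le_epsilon)
  show "1 \<le> hausdorff_dim (exceptional_set M0)"
    unfolding hausdorff_dim_def
  proof (rule INF_greatest, clarify, rule ccontr)
    fix s :: real
    assume zero: "0 \<le> s" "hausdorff_measure s (exceptional_set M0) = 0" and "\<not> 1 \<le> ennreal s"
    then have "s < 1" by (simp add: not_le)
    with zero(1) obtain c C g where c: "0 < c" and C: "0 \<le> C"
      and g: "\<And>t. t \<in> {0..<1} \<Longrightarrow> g t \<in> {1..2::real}"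
      and bad: "\<And>t p q. t \<in> {0..<1} \<Longrightarrow> 0 < (q::nat) \<Longrightarrow> c / real q \<le> \<bar>real q * g t - of_int p\<bar>"
      and expand: "\<And>t u. t \<in> {0..<1} \<Longrightarrow> u \<in> {0..<1} \<Longrightarrow> \<bar>t - u\<bar> \<le> C * \<bar>g t - g u\<bar> powr s"
      by (rule badly_approximable_cantor) blast
    \<comment> \<open>The parameters with b^2 rational; they are countable because \<open>g\<close>
      is injective, and hence Lebesgue null.\<close>
    define Z where "Z = {t \<in> {0..<1}. (g t)\<^sup>2 \<in> \<rat>}"
    have "inj_on (\<lambda>t. (g t)\<^sup>2) Z"
    proof (rule inj_onI)
      fix t u assume tu: "t \<in> Z" "u \<in> Z" "(g t)\<^sup>2 = (g u)\<^sup>2"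
      then have "g t = g u" using g[of t] g[of u] by (simp add: Z_def)
      \<comment> \<open>Equal images give the bound 0, also for \<open>s = 0\<close>, because
        \<open>0 powr 0 = 0\<close>.\<close>
      then show "t = u" using expand[of t u] tu by (simp add: Z_def)
    qed
    moreover have "countable ((\<lambda>t. (g t)\<^sup>2) ` Z)"
      by (rule countable_subset[OF _ countable_rat]) (auto simp: Z_def)
    ultimately have "countable Z" by (rule countable_image_inj_on[rotated])
    then have "Z \<in> null_sets lborel" by (rule countable_imp_null_set_lborel)
    then have T: "{0..<1} - Z \<in> sets lborel" "emeasure lborel ({0..<1} - Z) \<noteq> 0"
      by (auto simp: emeasure_Diff_null_set)
    have "hausdorff_measure s (exceptional_set M0) \<noteq> 0"
    proof (rule hausdorff_measure_nonzero_if_expanding[OF zero(1) _ T])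
      \<comment> \<open>Passing from \<open>g\<close> to the angle loses a factor 17/2 in distance,
        hence its power \<open>s\<close> in the constant.\<close>
      show "0 \<le> C * (17 / 2) powr s" using C by simp
      show "(\<lambda>t. 2 * pi - arctan ((g t)\<^sup>2)) ` ({0..<1} - Z) \<subseteq> exceptional_set M0"
      proof clarify
        fix t :: real assume "t \<in> {0..<1}" "t \<notin> Z"
        then show "2 * pi - arctan ((g t)\<^sup>2) \<in> exceptional_set M0"
          using g[of t] c bad[of t] by (intro exceptional_if_badly_approximable[of _ c]) (auto simp: Z_def)
      qed
      fix t u assume tu: "t \<in> {0..<1} - Z" "u \<in> {0..<1} - Z"
      let ?d = "dist (2 * pi - arctan ((g t)\<^sup>2)) (2 * pi - arctan ((g u)\<^sup>2))"
      have "\<bar>g t - g u\<bar> \<le> 17 / 2 * ?d"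
        using arctan_square_expanding[OF g g, of t u] tu by (simp add: dist_real_def abs_minus_commute)
      then have "\<bar>g t - g u\<bar> powr s \<le> (17 / 2 * ?d) powr s"
        using zero(1) by (intro powr_mono2) auto
      also have "\<dots> = (17 / 2) powr s * ?d powr s"
        by (rule powr_mult)
      finally have "C * \<bar>g t - g u\<bar> powr s \<le> C * ((17 / 2) powr s * ?d powr s)"
        using C by (rule mult_left_mono)
      then show "\<bar>t - u\<bar> \<le> C * (17 / 2) powr s * ?d powr s"
        using expand[of t u] tu by simp
    qed
    then show False using zero(2) by simp
  qed
qed

end
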